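(* Let $N$ be a positive integer. The path $P_N$ has the largest $\mathcal{H}_2$ norm of any tree with $N$ nodes; that is, $\mathcal{H}_2(T) \leq \mathcal{H}_2(P_N)$ for every tree $T$ with $N$ nodes.
   Context: All trees are finite, undirected, with unit weight on every edge. $P_N$ denotes the path graph on $N$ nodes (the unique tree with $N$ nodes and diameter $N-1$). $\mathcal{H}_2$ norm: for a connected undirected graph on $N$ nodes with Laplacian $L = D - A$ ($A$ the adjacency matrix, $D$ the diagonal matrix of degrees), let $0=\lambda_1 < \lambda_2 \leq \dots \leq \lambda_N$ be the eigenvalues of $L$. The $\mathcal{H}_2$ norm of the graph is $\mathcal{H}_2 = \left(\sum_{i=2}^{N}\frac{1}{2\lambda_i}\right)^{1/2}$. (This is the $\mathcal{H}_2$ norm of the system $\dot y = -QLQ^T y + Q\xi$ with output $z=y$, where the rows of $Q\in\mathbb{R}^{(N-1)\times N}$ form an orthonormal basis of the orthogonal complement of the all-ones vector.) *)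

theory Defs
  imports
    "Graph_Theory.Graph_Theory"
    "Jordan_Normal_Form.Char_Poly"
begin

text \<open>
  Finite simple undirected graphs are the symmetric digraphs of locale \<^locale>\<open>graph\<close>: an undirected
  edge is a pair of opposite arcs.  Such a pair already is a directed cycle of length two, so the
  library's \<^const>\<open>forest\<close> and \<^const>\<open>tree\<close> do not capture undirected acyclicity.  As a cycle has
  pairwise distinct vertices, the cycles of the undirected graph are exactly the directed cycles of
  length at least three.
\<close>

definition undirected_tree :: "('a, 'b) pre_digraph \<Rightarrow> bool" where
  "undirected_tree G \<longleftrightarrow>
     graph G \<and> Digraph_Component.connected G \<and> \<not> (\<exists>p. pre_digraph.cycle G p \<and> 3 \<le> length p)"

definition path_graph :: "nat \<Rightarrow> (nat, nat \<times> nat) pre_digraph" where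
  "path_graph N =
     \<lparr> verts = {0..<N},
       arcs = {(i, j). i < N \<and> j < N \<and> (j = Suc i \<or> i = Suc j)},
       tail = fst,
       head = snd \<rparr>"

text \<open>
  Matrices are indexed by numbers, so the vertices are numbered by some enumeration.  Another choice
  conjugates the matrices by a permutation and does not affect the spectrum.
\<close>

definition vertex_enum :: "('a, 'b) pre_digraph \<Rightarrow> 'a list" where
  "vertex_enum G = (SOME vs. distinct vs \<and> set vs = verts G)"

definition adjacency_mat :: "('a, 'b) pre_digraph \<Rightarrow> real mat" where
  "adjacency_mat G = mat (card (verts G)) (card (verts G))
     (\<lambda>(i, j). if vertex_enum G ! i \<rightarrow>\<^bsub>G\<^esub> vertex_enum G ! j then 1 else 0)"

text \<open>In a symmetric digraph the out-degree of a vertex is its degree in the undirected graph.\<close>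

definition degree_mat :: "('a, 'b) pre_digraph \<Rightarrow> real mat" where
  "degree_mat G = mat (card (verts G)) (card (verts G))
     (\<lambda>(i, j). if i = j then real (out_degree G (vertex_enum G ! i)) else 0)"

definition laplacian_mat :: "('a, 'b) pre_digraph \<Rightarrow> real mat" where
  "laplacian_mat G = degree_mat G - adjacency_mat G"

text \<open>
  The eigenvalues \<open>\<lambda>\<^sub>1 \<le> \<dots> \<le> \<lambda>\<^sub>N\<close> (numbered from 1) with multiplicity.  For an undirected graph the
  Laplacian is symmetric, so the real roots of its characteristic polynomial are all of its roots.
\<close>

definition laplacian_eigenvalue :: "('a, 'b) pre_digraph \<Rightarrow> nat \<Rightarrow> real" where
  "laplacian_eigenvalue G i =
     sorted_list_of_multiset (proots (char_poly (laplacian_mat G))) ! (i - 1)"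

definition H2_norm :: "('a, 'b) pre_digraph \<Rightarrow> real" where
  "H2_norm G = sqrt (\<Sum>i = 2..card (verts G). 1 / (2 * laplacian_eigenvalue G i))"

lemma graph_path_graph: "graph (path_graph N)"
proof -
  interpret wf_digraph "path_graph N"
    by unfold_locales (auto simp: path_graph_def)
  have "finite (arcs (path_graph N))"
    by (rule finite_subset[of _ "{0..<N} \<times> {0..<N}"]) (auto simp: path_graph_def)
  then show ?thesis
    by unfold_locales
      (auto simp: path_graph_def symmetric_conv arc_to_ends_def intro: bexI[of _ "(j, i)" for i j])
qed

lemma connected_path_graph:
  assumes "N > 0"
  shows "Digraph_Component.connected (path_graph N)"
proof -
  interpret graph "path_graph N" by (rule graph_path_graph)
  have from0: "0 \<rightarrow>\<^sup>*\<^bsub>path_graph N\<^esub> i" if "i < N" for i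
    using that
  proof (induction i)
    case 0
    then show ?case by (intro reachable_refl) (simp add: path_graph_def)
  next
    case (Suc i)
    have "i \<rightarrow>\<^bsub>path_graph N\<^esub> Suc i"
      using Suc.prems by (force simp: arcs_ends_conv path_graph_def)
    with Suc show ?case by (meson Suc_lessD reachable_adj_trans)
  qed
  have "u \<rightarrow>\<^sup>*\<^bsub>path_graph N\<^esub> v" if "u \<in> verts (path_graph N)" "v \<in> verts (path_graph N)" for u v
  proof (rule reachable_trans)
    show "u \<rightarrow>\<^sup>*\<^bsub>path_graph N\<^esub> 0"
      by (rule symmetric_reachable[OF sym_arcs from0]) (use that(1) in \<open>simp add: path_graph_def\<close>)
    show "0 \<rightarrow>\<^sup>*\<^bsub>path_graph N\<^esub> v"
      using that(2) by (intro from0) (simp add: path_graph_def)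
  qed
  then have "strongly_connected (path_graph N)"
    using assms by (auto simp: strongly_connected_def path_graph_def)
  then show ?thesis
    by (simp add: Digraph_Component.connected_def strongly_connected_def
        reachable_mk_symmetric_eq[OF sym_arcs])
qed

lemma cas_nth:
  "pre_digraph.cas G u p v \<Longrightarrow> i < length p \<Longrightarrow>
     tail G (p ! i) = (if i = 0 then u else head G (p ! (i - 1)))"
proof (induction p arbitrary: u i)
  case Nil
  then show ?case by simp
next
  case (Cons e p)
  then show ?case
    by (cases i) (auto simp: pre_digraph.cas.simps nth_Cons' split: if_splits)
qed

lemma no_long_cycle_path_graph:
  assumes "pre_digraph.cycle (path_graph N) p"
  shows "length p < 3"
proof (rule ccontr)
  assume "\<not> length p < 3"
  then have len: "3 \<le> length p" by simp
  let ?G = "path_graph N" and ?n = "length p"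
  interpret graph "path_graph N" by (rule graph_path_graph)
  obtain u where aw: "awalk u p u" and dist: "distinct (tl (awalk_verts u p))" and ne: "p \<noteq> []"
    using assms unfolding cycle_def by blast
  have cas: "cas u p u" and arcs: "set p \<subseteq> arcs ?G" using aw by (auto simp: awalk_def)
  have dist': "distinct (map snd p)"
    using dist ne awalk_verts_conv'[OF cas] by (simp add: path_graph_def)
  have last: "u = snd (last p)"
    using awlast_if_cas[OF cas] ne awalk_verts_conv[of u p] by (simp add: path_graph_def)
  define nx where "nx i = (if Suc i = ?n then 0 else Suc i)" for i
  have step: "fst (p ! nx i) = snd (p ! i)" if "i < ?n" for i
  proof (cases "Suc i = ?n")
    case True
    then have "last p = p ! i" using ne by (simp add: last_conv_nth flip: True)
    then show ?thesis
      using cas_nth[OF cas, of 0] last ne True by (simp add: nx_def path_graph_def)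
  next
    case False
    then show ?thesis
      using that cas_nth[OF cas, of "Suc i"] by (simp add: nx_def path_graph_def)
  qed
  have adj: "snd (p ! i) = Suc (fst (p ! i)) \<or> fst (p ! i) = Suc (snd (p ! i))" if "i < ?n" for i
    using arcs nth_mem[OF that] by (auto simp: path_graph_def)
  define m where "m = Max (set (map snd p))"
  have "m \<in> set (map snd p)" unfolding m_def using ne by (intro Max_in) auto
  then obtain j where j: "j < ?n" "snd (p ! j) = m" by (auto simp: in_set_conv_nth)
  have le: "snd (p ! i) \<le> m" if "i < ?n" for i
    unfolding m_def using that by (intro Max_ge) auto
  define i where "i = (if j = 0 then ?n - 1 else j - 1)"
  have i: "i < ?n" "nx i = j" using j len by (auto simp: i_def nx_def)
  have nxj: "nx j < ?n" using j len by (auto simp: nx_def)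
  have "snd (p ! i) = m - 1"
    using step[OF i(1)] adj[OF j(1)] le[OF i(1)] unfolding i(2) j(2) by linarith
  moreover have "snd (p ! nx j) = m - 1"
    using step[OF j(1)] adj[OF nxj] le[OF nxj] unfolding j(2) by linarith
  ultimately have "i = nx j"
    using dist' i(1) nxj by (metis length_map nth_eq_iff_index_eq nth_map)
  then show False using j len by (auto simp: i_def nx_def split: if_splits)
qed

lemma undirected_tree_path_graph: "N > 0 \<Longrightarrow> undirected_tree (path_graph N)"
  unfolding undirected_tree_def
  using graph_path_graph connected_path_graph no_long_cycle_path_graph leD by blast

lemma card_verts_path_graph: "card (verts (path_graph N)) = N"
  by (simp add: path_graph_def)

end

theory Submission
  imports Defs
begin

text \<open>
  For a tree on \<open>N\<close> vertices the sum of the reciprocals of the nonzero Laplacian eigenvalues is the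
  Wiener index divided by \<open>N\<close>, where the Wiener index is the sum of the distances over all unordered
  pairs of vertices.  The theorem thus reduces to the fact that among trees of a given size the path
  has the greatest Wiener index.

  \<^emph>\<open>Wiener index.\<close>  A leaf of a tree can be removed without changing the other distances.  The
  distances from any vertex to the vertices of a tree with \<open>n\<close> vertices take every value between
  \<open>0\<close> and their maximum, so they sum to at most \<open>0 + 1 + \<dots> + (n - 1)\<close>
  (\<open>sum_le_if_no_level_skipped\<close>).  Summing over the leaves as they are removed gives the bound
  \<open>wiener_sum_le\<close>, and the path attains it (\<open>wiener_sum_path\<close>).

  \<^emph>\<open>Spectrum.\<close>  Root the tree.  For a vertex \<open>e\<close> other than the root let \<open>f\<^sub>e\<close> be the indicator of the
  subtree below \<open>e\<close>, shifted to have sum zero, and let \<open>f\<^sub>r\<close> be the constant vector \<open>1\<close> for the root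
  \<open>r\<close>.  The only edge along which \<open>f\<^sub>e\<close> changes is the one above \<open>e\<close>, so in this family the Laplacian
  form has the matrix \<open>D = diag(0, 1, \<dots>, 1)\<close>, while the Gram matrix \<open>G\<close> has the entry \<open>N\<close> at the root,
  zeros in the remaining row and column of the root, and \<open>s * (N - s) / N\<close> on the diagonal, where
  \<open>s\<close> is the size of the subtree below \<open>e\<close>.  So the characteristic polynomial of the Laplacian is a
  constant multiple of \<open>det(x G - D)\<close>.  Its coefficients at \<open>x\<close> and \<open>x\<^sup>2\<close> can be read off the diagonal
  of \<open>G\<close> (\<open>det_isolated_row_mod_cube\<close>), and their ratio is minus the sum of the reciprocals of the
  nonzero eigenvalues (\<open>sum_inverse_roots\<close>).  Hence this sum equals the sum of \<open>s * (N - s) / N\<close> over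
  all edges.  As \<open>s * (N - s)\<close> is the number of pairs separated by the edge, it is the Wiener index
  divided by \<open>N\<close> (\<open>H2_norm_eq_wiener\<close>).
\<close>

section \<open>Distances in rooted trees\<close>

text \<open>
  If every positive value of \<open>f\<close> is one more than another value, then the values of \<open>f\<close> fill an
  initial segment \<open>{0..m}\<close>, so the maximum is less than the number of points.  Removing a point of
  maximal value preserves the hypothesis, and by induction the sum is at most \<open>0 + 1 + \<dots> + (n - 1)\<close>.
  For the distances from a vertex of a connected graph this says that the path with that vertex at
  one end is the worst case.
\<close>

lemma sum_le_if_no_level_skipped:
  fixes f :: "'a \<Rightarrow> nat"
  assumes "finite A" and "\<And>a. a \<in> A \<Longrightarrow> f a > 0 \<Longrightarrow> \<exists>b\<in>A. f a = Suc (f b)"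
  shows "2 * sum f A \<le> card A * (card A - 1)"
  using assms
proof (induction "card A" arbitrary: A)
  case 0
  then show ?case by simp
next
  case (Suc n)
  then have ne: "A \<noteq> {}" by auto
  note levels = Suc.prems(2)
  have "Max (f ` A) \<in> f ` A" using Suc.prems(1) ne by (intro Max_in) auto
  then obtain a where a: "a \<in> A" "f a = Max (f ` A)" by auto
  have le: "f b \<le> f a" if "b \<in> A" for b using that a(2) Suc.prems(1) by simp
  have "f a - j \<in> f ` A" for j
  proof (induction j)
    case 0
    then show ?case using a(1) by simp
  next
    case (Suc j)
    then obtain b where b: "b \<in> A" "f b = f a - j" by auto
    show ?case
    proof (cases "f b = 0")
      case True
      then show ?thesis using b by (auto intro!: image_eqI[of _ _ b])
    next
      case False
      then obtain c where "c \<in> A" "f b = Suc (f c)" using levels[of b] b by auto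
      then show ?thesis using b by (auto intro!: image_eqI[of _ _ c])
    qed
  qed
  then have "{..f a} \<subseteq> f ` A" by (metis atMost_iff diff_diff_cancel subsetI)
  then have "card {..f a} \<le> card (f ` A)" using Suc.prems(1) by (intro card_mono) auto
  also have "\<dots> \<le> card A" using Suc.prems(1) by (rule card_image_le)
  finally have fa: "f a \<le> n" using Suc.hyps(2) by simp
  have card: "card (A - {a}) = n" using Suc.hyps(2) a(1) by simp
  have "2 * sum f (A - {a}) \<le> n * (n - 1)"
  proof -
    have "\<exists>c\<in>A - {a}. f b = Suc (f c)" if b: "b \<in> A - {a}" "f b > 0" for b
    proof -
      obtain c where "c \<in> A" "f b = Suc (f c)" using levels[of b] b by auto
      moreover then have "c \<noteq> a" using le[of b] b by auto
      ultimately show ?thesis by auto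
    qed
    then show ?thesis using Suc.hyps(1)[of "A - {a}"] card Suc.prems(1) by auto
  qed
  moreover have "sum f A = f a + sum f (A - {a})" using Suc.prems(1) a(1) by (simp add: sum.remove)
  moreover have "n * (n - 1) + 2 * n = Suc n * n" by (cases n) auto
  ultimately show ?case using fa by (simp flip: Suc.hyps(2))
qed

text \<open>
  A rooted tree is given by the map that sends a vertex to its parent and fixes the root, so that
  iterating it is always meaningful.
\<close>

definition ancestors :: "('a \<Rightarrow> 'a) \<Rightarrow> 'a \<Rightarrow> 'a set" where
  "ancestors p v = range (\<lambda>k. (p ^^ k) v)"

text \<open>
  The path from \<open>u\<close> to \<open>v\<close> climbs to the lowest common ancestor and descends again.  The
  lower ends of its edges are the vertices that are ancestors of exactly one of \<open>u\<close> and \<open>v\<close> (every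
  vertex being an ancestor of itself), so counting these gives the length of the path.
\<close>

definition tree_dist :: "('a \<Rightarrow> 'a) \<Rightarrow> 'a \<Rightarrow> 'a \<Rightarrow> nat" where
  "tree_dist p u v = card (sym_diff (ancestors p u) (ancestors p v))"

lemma ancestors_unfold: "ancestors p v = insert v (ancestors p (p v))"
proof -
  have "range (\<lambda>k. (p ^^ k) v) = (\<lambda>k. (p ^^ k) v) ` (insert 0 (range Suc))"
    by (metis UNIV_nat_eq)
  also have "\<dots> = insert v (range (\<lambda>k. (p ^^ k) (p v)))"
    by (simp add: image_image funpow_swap1)
  finally show ?thesis by (simp add: ancestors_def)
qed

lemma ancestors_self: "v \<in> ancestors p v"
  by (subst ancestors_unfold) simp

lemma ancestors_subset: "w \<in> ancestors p v \<Longrightarrow> ancestors p w \<subseteq> ancestors p v"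
  by (auto simp: ancestors_def simp flip: funpow_add[THEN fun_cong, simplified])

lemma tree_dist_commute: "tree_dist p u v = tree_dist p v u"
  by (simp add: tree_dist_def Un_commute)

lemma tree_dist_self: "tree_dist p v v = 0"
  by (simp add: tree_dist_def)

text \<open>
  The height decreases towards the root; this excludes cycles of parents and makes the root an
  ancestor of every vertex.
\<close>

locale rooted_tree =
  fixes V :: "'a set" and r :: 'a and p :: "'a \<Rightarrow> 'a" and h :: "'a \<Rightarrow> nat"
  assumes finite_V: "finite V"
    and root_in: "r \<in> V"
    and parent_root: "p r = r"
    and parent_in: "v \<in> V \<Longrightarrow> p v \<in> V"
    and height_parent: "v \<in> V \<Longrightarrow> v \<noteq> r \<Longrightarrow> h (p v) < h v"
begin

abbreviation "anc \<equiv> ancestors p"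

lemma anc_subset_V: "v \<in> V \<Longrightarrow> anc v \<subseteq> V"
proof -
  assume "v \<in> V"
  then have "(p ^^ k) v \<in> V" for k by (induction k) (auto intro: parent_in)
  then show ?thesis by (auto simp: ancestors_def)
qed

lemma finite_anc: "v \<in> V \<Longrightarrow> finite (anc v)"
  using anc_subset_V finite_V finite_subset by blast

lemma height_anc: "v \<in> V \<Longrightarrow> w \<in> anc v \<Longrightarrow> h w \<le> h v"
proof -
  assume v: "v \<in> V" and "w \<in> anc v"
  then obtain k where w: "w = (p ^^ k) v" by (auto simp: ancestors_def)
  have "(p ^^ k) v \<in> V \<and> h ((p ^^ k) v) \<le> h v"
  proof (induction k)
    case 0
    then show ?case using v by simp
  next
    case (Suc k)
    then show ?case
      using parent_in[of "(p ^^ k) v"] height_parent[of "(p ^^ k) v"] parent_root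
      by (cases "(p ^^ k) v = r") auto
  qed
  then show ?thesis using w by simp
qed

lemma not_anc_parent: "v \<in> V \<Longrightarrow> v \<noteq> r \<Longrightarrow> v \<notin> anc (p v)"
  using height_anc[of "p v" v] height_parent[of v] parent_in[of v] by auto

lemma root_anc: "v \<in> V \<Longrightarrow> r \<in> anc v"
proof (induction "h v" arbitrary: v rule: less_induct)
  case less
  show ?case
  proof (cases "v = r")
    case True
    then show ?thesis by (simp add: ancestors_self)
  next
    case False
    then have "r \<in> anc (p v)" using less height_parent parent_in by blast
    then show ?thesis by (subst ancestors_unfold) simp
  qed
qed

text \<open>
  The witness is the neighbour of \<open>v\<close> on the path to \<open>u\<close>: the parent of \<open>v\<close>, unless \<open>v\<close> is an
  ancestor of \<open>u\<close>, when it is the child of \<open>v\<close> on the chain from \<open>u\<close> upwards.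
\<close>

lemma tree_dist_step:
  assumes u: "u \<in> V" and v: "v \<in> V" and ne: "u \<noteq> v"
  shows "\<exists>w\<in>V. tree_dist p u v = Suc (tree_dist p u w)"
proof (cases "v \<in> anc u")
  case False
  then have "v \<noteq> r" using root_anc u by auto
  then have v': "v \<notin> anc (p v)" using not_anc_parent v by auto
  have "sym_diff (anc u) (anc v) = insert v (sym_diff (anc u) (anc (p v)))"
    using v' False by (subst (1 2) ancestors_unfold[of p v]) auto
  moreover have "v \<notin> sym_diff (anc u) (anc (p v))" using v' False by auto
  moreover have "finite (sym_diff (anc u) (anc (p v)))" using finite_anc u v parent_in by auto
  ultimately have "tree_dist p u v = Suc (tree_dist p u (p v))" by (simp add: tree_dist_def)
  then show ?thesis using parent_in v by blast
next
  case True
  \<comment> \<open>With the least such \<open>k\<close>, the vertex before \<open>v\<close> differs from \<open>v\<close> even if \<open>v\<close> is the root, whose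
    parent is itself.\<close>
  define k where "k = (LEAST k. (p ^^ k) u = v)"
  have "\<exists>k. (p ^^ k) u = v" using True by (auto simp: ancestors_def)
  then have k: "(p ^^ k) u = v" unfolding k_def by (rule LeastI_ex)
  then obtain j where j: "k = Suc j" using ne by (cases k) auto
  define w where "w = (p ^^ j) u"
  have wv: "w \<noteq> v" using not_less_Least[of j "\<lambda>k. (p ^^ k) u = v"] j by (auto simp: k_def w_def)
  have pw: "p w = v" using k j by (simp add: w_def)
  have wu: "w \<in> anc u" by (auto simp: ancestors_def w_def)
  then have w: "w \<in> V" using anc_subset_V u by auto
  have wr: "w \<noteq> r" using wv pw parent_root by auto
  have aw: "anc w = insert w (anc v)" using ancestors_unfold[of p w] pw by simp
  have w': "w \<notin> anc v" using not_anc_parent w wr pw by auto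
  have sub: "anc w \<subseteq> anc u" using wu by (rule ancestors_subset)
  have "sym_diff (anc u) (anc v) = insert w (sym_diff (anc u) (anc w))"
    using sub w' wu unfolding aw by auto
  moreover have "w \<notin> sym_diff (anc u) (anc w)" using wu by (simp add: ancestors_self)
  moreover have "finite (sym_diff (anc u) (anc w))" using finite_anc u w by auto
  ultimately have "tree_dist p u v = Suc (tree_dist p u w)" by (simp add: tree_dist_def)
  then show ?thesis using w by blast
qed

lemma sum_tree_dist_le:
  assumes "u \<in> V"
  shows "2 * (\<Sum>v\<in>V. tree_dist p u v) \<le> card V * (card V - 1)"
  using assms tree_dist_step by (intro sum_le_if_no_level_skipped finite_V) (metis tree_dist_self less_irrefl)

end

text \<open>
  Twice the Wiener index, since each unordered pair of vertices is counted in both orders.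
\<close>

definition wiener_sum :: "('a \<Rightarrow> 'a) \<Rightarrow> 'a set \<Rightarrow> nat" where
  "wiener_sum p V = (\<Sum>u\<in>V. \<Sum>v\<in>V. tree_dist p u v)"

lemma wiener_sum_insert:
  assumes "finite V" "u \<notin> V"
  shows "wiener_sum p (insert u V) = wiener_sum p V + 2 * (\<Sum>v\<in>insert u V. tree_dist p u v)"
  using assms by (simp add: wiener_sum_def sum.distrib tree_dist_self tree_dist_commute[of p _ u])

text \<open>
  Remove a vertex \<open>u\<close> of greatest height.  It is a leaf, so the rest is again a rooted tree with the
  same parents and hence the same distances, and the pairs that contain \<open>u\<close> contribute at most
  \<open>k * Suc k\<close> if \<open>k\<close> vertices remain.
\<close>

lemma wiener_sum_le:
  assumes "rooted_tree V r p h"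
  shows "wiener_sum p V \<le> (\<Sum>k<card V. k * Suc k)"
  using assms
proof (induction "card V" arbitrary: V rule: less_induct)
  case less
  interpret rooted_tree V r p h by (rule less.prems)
  show ?case
  proof (cases "V = {r}")
    case True
    then show ?thesis by (simp add: wiener_sum_def tree_dist_self)
  next
    case False
    then have ne: "V - {r} \<noteq> {}" using root_in by auto
    have "Max (h ` (V - {r})) \<in> h ` (V - {r})" using finite_V ne by (intro Max_in) auto
    then obtain u where "u \<in> V - {r}" and u3: "Max (h ` (V - {r})) = h u" by (rule imageE)
    then have u: "u \<in> V" "u \<noteq> r" by auto
    have top: "h v \<le> h u" if "v \<in> V" "v \<noteq> r" for v
      using that finite_V unfolding u3[symmetric] by (intro Max_ge) auto
    have T: "rooted_tree (V - {u}) r p h"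
    proof
      fix v assume "v \<in> V - {u}"
      then show "p v \<in> V - {u}"
        using parent_in[of v] height_parent[of v] top[of v] parent_root u(2) by (cases "v = r") auto
    qed (use finite_V root_in parent_root height_parent u in auto)
    obtain n where n: "card V = Suc n" "card (V - {u}) = n"
      using u(1) finite_V by (metis card_Suc_Diff1)
    have "wiener_sum p V = wiener_sum p (V - {u}) + 2 * (\<Sum>v\<in>V. tree_dist p u v)"
      using wiener_sum_insert[of "V - {u}" u p] finite_V u(1) by (simp add: insert_absorb)
    also have "\<dots> \<le> (\<Sum>k<n. k * Suc k) + Suc n * n"
      using less.hyps[OF _ T] sum_tree_dist_le[OF u(1)] n by (intro add_mono) auto
    finally show ?thesis by (simp add: n)
  qed
qed

text \<open>
  The path attains the bound: its last vertex sees the others at distances \<open>1, 2, \<dots>\<close> without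
  repetition.
\<close>

lemma wiener_sum_path: "wiener_sum (\<lambda>v. v - 1) {..<N} = (\<Sum>k<N. k * Suc k)"
proof (induction N)
  case 0
  then show ?case by (simp add: wiener_sum_def)
next
  case (Suc N)
  have anc: "ancestors (\<lambda>v::nat. v - 1) v = {..v}" for v
  proof -
    have "((\<lambda>v::nat. v - 1) ^^ k) v = v - k" for k by (induction k) auto
    then have "ancestors (\<lambda>v::nat. v - 1) v = range (\<lambda>k. v - k)" by (simp add: ancestors_def)
    also have "\<dots> = {..v}" by (auto simp: image_iff) (metis diff_diff_cancel)
    finally show ?thesis .
  qed
  have "tree_dist (\<lambda>v. v - 1) N v = N - v" if "v \<le> N" for v
  proof -
    have "sym_diff {..N} {..v} = {v<..N}" using that by auto
    then show ?thesis by (simp only: tree_dist_def anc card_greaterThanAtMost)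
  qed
  then have "(\<Sum>v<Suc N. tree_dist (\<lambda>v. v - 1) N v) = (\<Sum>v<Suc N. N - v)"
    by (intro sum.cong) auto
  also have "\<dots> = (\<Sum>v<Suc N. v)" using sum.nat_diff_reindex[of "\<lambda>v. v" "Suc N"] by simp
  also have "2 * \<dots> = N * Suc N"
    by (induction N) auto
  finally have "2 * (\<Sum>v<Suc N. tree_dist (\<lambda>v. v - 1) N v) = N * Suc N" by simp
  then show ?case using Suc.IH wiener_sum_insert[of "{..<N}" N] by (simp add: lessThan_Suc)
qed

section \<open>Subtree sizes\<close>

definition descendant :: "('a \<Rightarrow> 'a) \<Rightarrow> 'a \<Rightarrow> 'a \<Rightarrow> real" where
  "descendant p e v = of_bool (e \<in> ancestors p v)"

context rooted_tree begin

abbreviation "subtree_size e \<equiv> \<Sum>v\<in>V. descendant p e v"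

text \<open>
  Double counting: the edge from \<open>e\<close> to its parent lies on the path from \<open>u\<close> to \<open>v\<close> if and only if
  exactly one of the two is below \<open>e\<close>.  The root has no such edge, and its term vanishes because its
  subtree is everything.
\<close>

lemma wiener_sum_subtree_sizes:
  "real (wiener_sum p V) = 2 * (\<Sum>e\<in>V. subtree_size e * (card V - subtree_size e))"
proof -
  have dist: "real (tree_dist p u v) = (\<Sum>e\<in>V. (descendant p e u - descendant p e v)\<^sup>2)"
    if "u \<in> V" "v \<in> V" for u v
  proof -
    have "sym_diff (anc u) (anc v) = {e\<in>V. (e \<in> anc u) \<noteq> (e \<in> anc v)}"
      using anc_subset_V that by blast
    then have "real (tree_dist p u v) = (\<Sum>e\<in>V. of_bool ((e \<in> anc u) \<noteq> (e \<in> anc v)))"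
      using finite_V by (simp add: tree_dist_def Int_def)
    also have "\<dots> = (\<Sum>e\<in>V. (descendant p e u - descendant p e v)\<^sup>2)"
      by (intro sum.cong) (auto simp: descendant_def)
    finally show ?thesis .
  qed
  have sq: "(\<Sum>u\<in>V. (descendant p e u)\<^sup>2) = subtree_size e" for e
    by (intro sum.cong) (auto simp: descendant_def)
  have "real (wiener_sum p V) = (\<Sum>u\<in>V. \<Sum>v\<in>V. \<Sum>e\<in>V. (descendant p e u - descendant p e v)\<^sup>2)"
    by (simp add: wiener_sum_def dist)
  also have "\<dots> = (\<Sum>u\<in>V. \<Sum>e\<in>V. \<Sum>v\<in>V. (descendant p e u - descendant p e v)\<^sup>2)"
    by (intro sum.cong refl sum.swap)
  also have "\<dots> = (\<Sum>e\<in>V. \<Sum>u\<in>V. \<Sum>v\<in>V. (descendant p e u - descendant p e v)\<^sup>2)"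
    by (rule sum.swap)
  also have "\<dots> = (\<Sum>e\<in>V. 2 * (subtree_size e * (card V - subtree_size e)))"
    by (intro sum.cong refl)
      (simp add: power2_diff sum.distrib sum_subtractf sq sum_distrib_left[symmetric]
        sum_distrib_right[symmetric] mult.assoc, simp add: algebra_simps power2_eq_square)
  finally show ?thesis by (simp add: sum_distrib_left)
qed

lemma subtree_size_root: "subtree_size r = card V"
  using root_anc by (simp add: descendant_def)

text \<open>
  The indicator of the subtree below \<open>e\<close> jumps across no edge except the one above \<open>e\<close>.  This
  duality between subtrees and edges diagonalises the Laplacian form.
\<close>

lemma descendant_diff:
  assumes "v \<in> V" "v \<noteq> r"
  shows "descendant p e v - descendant p e (p v) = of_bool (e = v)"
  using not_anc_parent[OF assms] ancestors_unfold[of p v] by (auto simp: descendant_def)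

end

section \<open>Low coefficients of characteristic polynomials\<close>

text \<open>
  The logarithmic derivative at zero of a product of linear factors.
\<close>

lemma coeff_prod_linear:
  fixes a b :: "'i \<Rightarrow> 'c::field"
  assumes "\<And>i. i \<in># M \<Longrightarrow> a i \<noteq> 0"
  shows "coeff (\<Prod>i\<in>#M. [:a i, b i:]) 0 = (\<Prod>i\<in>#M. a i)"
    and "coeff (\<Prod>i\<in>#M. [:a i, b i:]) 1 = (\<Prod>i\<in>#M. a i) * (\<Sum>i\<in>#M. b i / a i)"
proof -
  show 0: "coeff (\<Prod>i\<in>#M. [:a i, b i:]) 0 = (\<Prod>i\<in>#M. a i)" for M
    by (induction M) (auto simp: coeff_mult)
  show "coeff (\<Prod>i\<in>#M. [:a i, b i:]) 1 = (\<Prod>i\<in>#M. a i) * (\<Sum>i\<in>#M. b i / a i)"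
    using assms
  proof (induction M)
    case empty
    then show ?case by simp
  next
    case (add i M)
    let ?P = "\<Prod>i\<in>#M. a i" and ?S = "\<Sum>i\<in>#M. b i / a i"
    have ai: "a i \<noteq> 0" using add.prems by simp
    have "coeff (\<Prod>i\<in>#add_mset i M. [:a i, b i:]) 1
        = a i * coeff (\<Prod>i\<in>#M. [:a i, b i:]) 1 + b i * coeff (\<Prod>i\<in>#M. [:a i, b i:]) 0"
      by simp
    also have "\<dots> = a i * (?P * ?S) + b i * ?P" using add 0[of M] by simp
    also have "\<dots> = a i * ?P * (b i / a i + ?S)"
    proof -
      have "a i * (P * S) + b i * P = a i * P * (b i / a i + S)" for P S
        using ai by (simp add: field_simps)
      then show ?thesis .
    qed
    finally show ?case by simp
  qed
qed

text \<open>
  The matrix is \<open>x g - D\<close> with \<open>D\<close> the identity apart from a zero at \<open>(k, k)\<close>.  In the Leibniz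
  expansion a permutation that moves \<open>k\<close> contributes nothing, and any other permutation apart from
  the identity moves two further indices, which together with \<open>k\<close> give three factors divisible by
  \<open>x\<close>.  Hence modulo \<open>x\<^sup>3\<close> only the diagonal matters.
\<close>

lemma det_isolated_row_mod_cube:
  fixes g :: "nat \<Rightarrow> nat \<Rightarrow> 'a::comm_ring_1"
  assumes k: "k < n" and row: "\<forall>j<n. j \<noteq> k \<longrightarrow> g k j = 0"
  defines "A \<equiv> mat n n (\<lambda>(i, j). [: - of_bool (i = j \<and> i \<noteq> k), g i j:])"
  shows "[:0, 1:] ^ 3 dvd det A - [:0, g k k:] * (\<Prod>i\<in>{0..<n} - {k}. [:-1, g i i:])"
proof -
  let ?P = "{p. p permutes {0..<n}}"
  let ?t = "\<lambda>p. signof p * (\<Prod>i = 0..<n. A $$ (i, p i))"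
  have fin: "finite ?P" by (simp add: finite_permutations)
  have "det A = ?t id + sum ?t (?P - {id})"
    using sum.remove[OF fin, of id ?t] det_def'[of A n] by (simp add: A_def permutes_id)
  also have "?t id = [:0, g k k:] * (\<Prod>i\<in>{0..<n} - {k}. [:-1, g i i:])"
    using k by (subst prod.remove[of _ k]) (auto simp: A_def intro!: prod.cong)
  finally have "det A - [:0, g k k:] * (\<Prod>i\<in>{0..<n} - {k}. [:-1, g i i:]) = sum ?t (?P - {id})"
    by (simp only: add_diff_cancel_left')
  moreover have "[:0, 1:] ^ 3 dvd ?t p" if p: "p \<in> ?P - {id}" for p
  proof (cases "p k = k")
    case False
    have "p k < n" using p k permutes_in_image[of p "{0..<n}" k] by auto
    then have "A $$ (k, p k) = 0" using False k row by (simp add: A_def)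
    then have "(\<Prod>i = 0..<n. A $$ (i, p i)) = 0" using k by (intro prod_zero) auto
    then show ?thesis by (simp only: mult_zero_right dvd_0_right)
  next
    case True
    have perm: "p permutes {0..<n}" using p by auto
    obtain i where i: "p i \<noteq> i" using p by (auto simp: fun_eq_iff)
    have inj: "inj p" using perm by (rule permutes_inj)
    \<comment> \<open>A permutation cannot move exactly one index, so \<open>j\<close> is moved as well.\<close>
    define j where "j = p i"
    have j: "p j \<noteq> j" "j \<noteq> i" "j \<noteq> k" "i \<noteq> k"
      using i True inj by (auto simp: j_def inj_eq dest: injD[OF inj, of i k])
    have ij: "i < n" "j < n" using perm i j(1) by (auto simp: permutes_def)
    have dvd: "[:0, 1:] dvd A $$ (l, p l)" if "l \<in> {i, j, k}" for l
    proof -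
      have "p l < n" "l < n" using perm that ij k by (auto simp: permutes_in_image)
      then have "A $$ (l, p l) = [:0, g l (p l):]"
        using that i j by (auto simp: A_def)
      also have "\<dots> = [:0, 1:] * [:g l (p l):]" by simp
      finally show ?thesis by (metis dvd_triv_left)
    qed
    have "(\<Prod>l\<in>{i, j, k}. [:0, 1:]) dvd (\<Prod>l\<in>{i, j, k}. A $$ (l, p l))"
      using dvd by (rule prod_dvd_prod)
    also have "\<dots> dvd (\<Prod>l = 0..<n. A $$ (l, p l))"
      using ij k by (intro prod_dvd_prod_subset) auto
    finally have "[:0, 1:] ^ 3 dvd (\<Prod>l = 0..<n. A $$ (l, p l))"
      using j by (simp add: numeral_3_eq_3 mult.assoc)
    then show ?thesis by (rule dvd_mult)
  qed
  ultimately show ?thesis by (auto intro: dvd_sum)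
qed

lemma coeff_eq_if_dvd_diff_X_power:
  fixes f g :: "'a::comm_ring_1 poly"
  assumes "[:0, 1:] ^ m dvd f - g" "i < m"
  shows "coeff f i = coeff g i"
proof -
  obtain q where "f - g = [:0, 1:] ^ m * q" using assms(1) by (auto elim: dvdE)
  then have "coeff (f - g) i = coeff (monom 1 m * q) i" by (simp add: monom_altdef)
  then show ?thesis using assms(2) by (simp add: coeff_monom_mult)
qed

text \<open>
  Multiplying \<open>x - L\<close> by \<open>F\<close> on the left and by its transpose on the right turns the characteristic
  polynomial into the determinant of the pencil \<open>x g - d\<close>, up to the constant \<open>(det F)\<^sup>2\<close>.
\<close>

lemma char_poly_congruence:
  fixes L F :: "'a::comm_ring_1 mat"
  assumes L: "L \<in> carrier_mat n n" and F: "F \<in> carrier_mat n n"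
    and D: "F * L * transpose_mat F = mat n n (\<lambda>(i, j). d i j)"
    and G: "F * transpose_mat F = mat n n (\<lambda>(i, j). g i j)"
  shows "[:det F ^ 2:] * char_poly L = det (mat n n (\<lambda>(i, j). [: - d i j, g i j:]))"
proof -
  interpret lift: comm_ring_hom "\<lambda>a::'a. [:a:]" by unfold_locales (auto simp: one_pCons)
  let ?l = "map_mat (\<lambda>a::'a. [:a:])" and ?x = "[:0, 1:] :: 'a poly"
  have cF: "?l F \<in> carrier_mat n n" "transpose_mat (?l F) \<in> carrier_mat n n"
    and cL: "?l L \<in> carrier_mat n n" using F L by auto
  have FL: "F * L \<in> carrier_mat n n" and Ft: "transpose_mat F \<in> carrier_mat n n" using F L by auto
  have c: "char_poly_matrix L = ?x \<cdot>\<^sub>m 1\<^sub>m n - ?l L"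
    using L by (intro eq_matI) (auto simp: char_poly_matrix_def)
  have t: "transpose_mat (?l F) = ?l (transpose_mat F)" using F by (intro eq_matI) auto
  have "?l F * char_poly_matrix L * transpose_mat (?l F)
      = ?x \<cdot>\<^sub>m (?l F * transpose_mat (?l F)) - ?l F * ?l L * transpose_mat (?l F)"
    unfolding c using cF cL
    by (simp add: mult_minus_distrib_mat[of _ n n _ n] minus_mult_distrib_mat[of _ n n _ _ n]
        mult_smult_distrib[of _ n n _ n] mult_smult_assoc_mat[of _ n n _ n])
  also have "?l F * transpose_mat (?l F) = ?l (mat n n (\<lambda>(i, j). g i j))"
    unfolding t using lift.mat_hom_mult[OF F Ft] G by simp
  also have "?l F * ?l L * transpose_mat (?l F) = ?l (mat n n (\<lambda>(i, j). d i j))"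
    unfolding t using lift.mat_hom_mult[OF F L] lift.mat_hom_mult[OF FL Ft] D by simp
  also have "?x \<cdot>\<^sub>m ?l (mat n n (\<lambda>(i, j). g i j)) - ?l (mat n n (\<lambda>(i, j). d i j))
      = mat n n (\<lambda>(i, j). [: - d i j, g i j:])"
    by (intro eq_matI) auto
  finally have "det (?l F * char_poly_matrix L * transpose_mat (?l F))
      = det (mat n n (\<lambda>(i, j). [: - d i j, g i j:]))" by simp
  moreover have "det (?l F) = [:det F:]" by (simp add: lift.hom_det)
  ultimately show ?thesis
    using cF L det_transpose[OF cF(1)]
    by (simp add: det_mult[of _ n] char_poly_def power2_eq_square mult_ac)
qed

text \<open>
  Both coefficients of the pencil carry the same factor \<open>(det F)\<^sup>2\<close>, which cancels.  It is nonzero,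
  since otherwise the pencil would have determinant zero, but its coefficient at \<open>x\<close> is \<open>g k k\<close> up
  to sign.
\<close>

lemma char_poly_low_coeffs:
  fixes L F :: "real mat"
  assumes L: "L \<in> carrier_mat n n" and F: "F \<in> carrier_mat n n" and k: "k < n"
    and D: "F * L * transpose_mat F = mat n n (\<lambda>(i, j). of_bool (i = j \<and> i \<noteq> k))"
    and G: "F * transpose_mat F = mat n n (\<lambda>(i, j). g i j)"
    and row: "\<forall>j<n. j \<noteq> k \<longrightarrow> g k j = 0" and gkk: "g k k \<noteq> 0"
  shows "coeff (char_poly L) 0 = 0" and "coeff (char_poly L) 1 \<noteq> 0"
    and "coeff (char_poly L) 2 = - coeff (char_poly L) 1 * (\<Sum>i\<in>{0..<n} - {k}. g i i)"
proof -
  let ?q = "\<Prod>i\<in>{0..<n} - {k}. [:-1, g i i:]" and ?I = "mset_set ({0..<n} - {k})"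
  let ?s = "\<Sum>i\<in>{0..<n} - {k}. g i i"
  have eq: "det F ^ 2 * coeff (char_poly L) i = coeff ([:0, g k k:] * ?q) i" if "i < 3" for i
  proof -
    have "det F ^ 2 * coeff (char_poly L) i = coeff ([:det F ^ 2:] * char_poly L) i" by simp
    also have "\<dots> = coeff ([:0, g k k:] * ?q) i"
      unfolding char_poly_congruence[OF L F D G]
      using coeff_eq_if_dvd_diff_X_power[OF det_isolated_row_mod_cube[OF k, of g, OF row] that]
      by simp
    finally show ?thesis .
  qed
  have q0: "coeff ?q 0 = (-1) ^ card ({0..<n} - {k})"
    using coeff_prod_linear(1)[of ?I "\<lambda>_. -1::real" "\<lambda>i. g i i"]
    by (simp add: prod_unfold_prod_mset[symmetric])
  have q1: "coeff ?q 1 = (-1) ^ card ({0..<n} - {k}) * - ?s"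
    using coeff_prod_linear(2)[of ?I "\<lambda>_. -1::real" "\<lambda>i. g i i"]
    by (simp add: prod_unfold_prod_mset[symmetric] sum_unfold_sum_mset[symmetric] sum_negf)
  have c1: "det F ^ 2 * coeff (char_poly L) 1 = g k k * coeff ?q 0" using eq[of 1] by simp
  have c2: "det F ^ 2 * coeff (char_poly L) 2 = g k k * coeff ?q 1"
    using eq[of 2] by (simp add: numeral_2_eq_2)
  have ne: "det F ^ 2 * coeff (char_poly L) 1 \<noteq> 0" unfolding c1 q0 using gkk by simp
  then show "coeff (char_poly L) 1 \<noteq> 0" by auto
  have dF: "det F \<noteq> 0" using ne by auto
  show "coeff (char_poly L) 0 = 0" using eq[of 0] dF by simp
  have "det F ^ 2 * coeff (char_poly L) 2 = det F ^ 2 * (- coeff (char_poly L) 1 * ?s)"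
    using c1 c2 q0 q1 by (simp add: mult.assoc[symmetric])
  then show "coeff (char_poly L) 2 = - coeff (char_poly L) 1 * ?s" using dF by (subst (asm) mult_left_cancel) auto
qed

text \<open>
  Over the complex numbers the characteristic polynomial splits.  If \<open>v\<close> is an eigenvector for \<open>a\<close>,
  the form at \<open>v\<close> equals \<open>a\<close> times the squared length of \<open>v\<close>, so \<open>a\<close> is real and nonnegative.  The
  splitting therefore already takes place over the reals.
\<close>

lemma real_roots_nonneg_if_form_nonneg:
  fixes L :: "real mat"
  assumes L: "L \<in> carrier_mat n n"
    and form: "\<And>x :: nat \<Rightarrow> complex. \<exists>c\<ge>0. (\<Sum>i<n. \<Sum>j<n. cnj (x i) * of_real (L $$ (i, j)) * x j) = of_real c"
  shows "\<exists>bs. char_poly L = (\<Prod>b\<leftarrow>bs. [:- b, 1:]) \<and> length bs = n \<and> (\<forall>b\<in>set bs. b \<ge> 0)"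
proof -
  let ?C = "map_mat complex_of_real L"
  have C: "?C \<in> carrier_mat n n" using L by simp
  obtain as where as: "char_poly ?C = (\<Prod>a\<leftarrow>as. [:- a, 1:])" "length as = n"
    using char_poly_factorized[OF C] by auto
  have nonneg: "\<exists>b\<ge>0. a = of_real b" if "a \<in> set as" for a
  proof -
    have "poly (char_poly ?C) a = 0" unfolding as(1) using that by (simp add: poly_prod_list prod_list_zero_iff image_iff)
    then obtain v where v: "v \<in> carrier_vec n" "v \<noteq> 0\<^sub>v n" "?C *\<^sub>v v = a \<cdot>\<^sub>v v"
      using eigenvalue_root_char_poly[OF C] L by (auto simp: eigenvalue_def eigenvector_def)
    obtain c where c: "c \<ge> 0"
      "(\<Sum>i<n. \<Sum>j<n. cnj (v $ i) * of_real (L $$ (i, j)) * v $ j) = complex_of_real c"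
      using form[of "\<lambda>i. v $ i"] by auto
    have "(\<Sum>i<n. \<Sum>j<n. cnj (v $ i) * of_real (L $$ (i, j)) * v $ j)
        = (\<Sum>i<n. cnj (v $ i) * (?C *\<^sub>v v) $ i)"
      using v(1) L by (intro sum.cong)
        (auto simp: scalar_prod_def sum_distrib_left mult_ac atLeast0LessThan)
    also have "\<dots> = (\<Sum>i<n. a * of_real ((cmod (v $ i))\<^sup>2))"
      unfolding v(3) using v(1) by (intro sum.cong)
        (auto simp: complex_norm_square mult_ac simp del: of_real_power)
    also have "\<dots> = a * of_real (\<Sum>i<n. (cmod (v $ i))\<^sup>2)" by (simp add: sum_distrib_left)
    finally have ac: "of_real c = a * of_real (\<Sum>i<n. (cmod (v $ i))\<^sup>2)" using c by simp
    obtain i where i: "i < n" "v $ i \<noteq> 0" using v(1,2) by (metis carrier_vecD eq_vecI index_zero_vec)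
    define S where "S = (\<Sum>i<n. (cmod (v $ i))\<^sup>2)"
    have pos: "S > 0" unfolding S_def using i by (intro sum_pos2[of _ i]) auto
    then have "a = of_real (c / S)" using ac by (simp add: field_simps flip: S_def)
    then show ?thesis using c(1) pos by (metis divide_nonneg_pos)
  qed
  then obtain f where f: "\<And>a. a \<in> set as \<Longrightarrow> f a \<ge> 0 \<and> a = of_real (f a)" by metis
  define bs where "bs = map f as"
  interpret h: map_poly_inj_idom_hom complex_of_real ..
  have "map_poly complex_of_real (char_poly L) = char_poly ?C"
    by (rule of_real_hom.char_poly_hom[OF L, symmetric])
  also have "\<dots> = (\<Prod>b\<leftarrow>bs. [:- of_real b, 1:])"
    unfolding as(1) bs_def map_map using f by (intro arg_cong[where f = prod_list] map_cong) auto
  also have "\<dots> = map_poly complex_of_real (\<Prod>b\<leftarrow>bs. [:- b, 1:])"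
    by (simp add: h.hom_prod_list o_def)
  finally have "char_poly L = (\<Prod>b\<leftarrow>bs. [:- b, 1:])" using h.injectivity by blast
  then show ?thesis using as(2) f by (intro exI[of _ bs]) (auto simp: bs_def)
qed

text \<open>
  As zero is a simple root and the others are positive, the smallest root in the sorted list is the
  zero one.  Dividing \<open>q\<close> by \<open>x\<close> leaves a polynomial with the remaining roots, whose two lowest
  coefficients have ratio minus the sum of the reciprocals.
\<close>

lemma sum_inverse_roots:
  fixes bs :: "real list"
  assumes q: "q = (\<Prod>b\<leftarrow>bs. [:- b, 1:])" and nonneg: "\<forall>b\<in>set bs. b \<ge> 0"
    and c0: "coeff q 0 = 0" and c1: "coeff q 1 \<noteq> 0"
  shows "(\<Sum>i = 2..length bs. 1 / (2 * sorted_list_of_multiset (proots q) ! (i - 1)))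
    = - coeff q 2 / (2 * coeff q 1)"
proof -
  have "poly q 0 = 0" using c0 by (simp add: poly_0_coeff_0)
  then have "0 \<in> set bs" by (auto simp: q poly_prod_list prod_list_zero_iff)
  define cs where "cs = sort (remove1 0 bs)"
  have mset: "mset bs = add_mset 0 (mset cs)" using \<open>0 \<in> set bs\<close> by (simp add: cs_def)
  have proots: "proots q = mset bs"
    unfolding q
  proof (induction bs)
    case (Cons b bs)
    have "(\<Prod>b\<leftarrow>bs. [:- b, 1:]) \<noteq> 0" by (auto simp: prod_list_zero_iff)
    then show ?case using Cons.IH by (simp add: proots_mult del: mult_pCons_left)
  qed simp
  have "sorted (0 # cs)"
    using nonneg set_remove1_subset[of 0 bs] by (auto simp: cs_def)
  then have "sort bs = 0 # cs" using mset by (intro properties_for_sort) auto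
  then have sorted: "sorted_list_of_multiset (proots q) = 0 # cs" using proots by simp
  let ?q = "\<Prod>b\<in>#mset cs. [:- b, 1:]"
  have "q = (\<Prod>b\<in>#mset bs. [:- b, 1:])"
    unfolding q by (metis mset_map prod_mset_prod_list)
  also have "\<dots> = [:0, 1:] * ?q" unfolding mset by simp
  finally have q': "q = [:0, 1:] * ?q" .
  have d1: "coeff q 1 = coeff ?q 0" and d2: "coeff q 2 = coeff ?q 1"
    unfolding q' by (simp_all add: numeral_2_eq_2)
  have ne: "b \<noteq> 0" if "b \<in># mset cs" for b
  proof
    assume "b = 0"
    then have "poly ?q 0 = 0" using that by (auto simp: poly_prod_mset prod_mset_zero_iff)
    then show False using c1 d1 by (simp add: poly_0_coeff_0)
  qed
  have "coeff q 2 = coeff q 1 * (\<Sum>b\<in>#mset cs. 1 / - b)"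
    unfolding d1 d2 using coeff_prod_linear[of "mset cs" uminus "\<lambda>_. 1"] ne by simp
  also have "(\<Sum>b\<in>#mset cs. 1 / - b) = - (\<Sum>b\<leftarrow>cs. 1 / b)"
    by (induction cs) auto
  finally have "- coeff q 2 / (2 * coeff q 1) = (\<Sum>b\<leftarrow>cs. 1 / b) / 2" using c1 by simp
  also have "\<dots> = (\<Sum>i<length cs. 1 / (2 * cs ! i))"
    by (simp add: sum_list_sum_nth sum_divide_distrib atLeast0LessThan mult_ac)
  also have "\<dots> = (\<Sum>i = 2..length bs. 1 / (2 * (0 # cs) ! (i - 1)))"
  proof -
    have len: "length bs = Suc (length cs)" using mset by (metis size_add_mset size_mset)
    \<comment> \<open>List positions start at 0 and the zero root comes first, so \<open>cs ! i\<close> is root number \<open>i + 2\<close>.\<close>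
    show ?thesis
      by (rule sum.reindex_bij_witness[of _ "\<lambda>i. i - 2" "\<lambda>i. i + 2"])
        (auto simp: len nth_Cons' Suc_diff_le numeral_2_eq_2)
  qed
  finally show ?thesis by (simp add: sorted)
qed

section \<open>The Laplacian spectrum of a tree\<close>

text \<open>
  The arcs of an undirected graph come in opposite pairs, so each edge appears both upwards and
  downwards.
\<close>

locale parent_tree_graph = graph G + rooted_tree "verts G" r p h
  for G :: "('a, 'b) pre_digraph" (structure) and r p h +
  assumes adj_iff_parent:
    "u \<rightarrow>\<^bsub>G\<^esub> w \<longleftrightarrow> (u \<in> verts G - {r} \<and> w = p u) \<or> (w \<in> verts G - {r} \<and> u = p w)"
begin

lemma sum_arcs_ends:
  "(\<Sum>(u, w)\<in>arcs_ends G. f u w) = (\<Sum>v\<in>verts G - {r}. f v (p v) + f (p v) v)"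
proof -
  let ?E = "verts G - {r}"
  have "arcs_ends G = (\<lambda>v. (v, p v)) ` ?E \<union> (\<lambda>v. (p v, v)) ` ?E"
  proof -
    have "(u \<in> E \<and> w = p u) \<or> (w \<in> E \<and> u = p w)
        \<longleftrightarrow> (\<exists>v\<in>E. u = v \<and> w = p v) \<or> (\<exists>v\<in>E. u = p v \<and> w = v)" for u w E
      by blast
    then show ?thesis
      unfolding set_eq_iff split_paired_All adj_iff_parent Un_iff image_iff prod.inject by simp
  qed
  moreover have "(\<lambda>v. (v, p v)) ` ?E \<inter> (\<lambda>v. (p v, v)) ` ?E = {}"
  proof -
    have no_2_cycle: False if "v \<in> ?E" "w \<in> ?E" "w = p v" "v = p w" for v w
    proof -
      have "h w < h v" unfolding that(3) using that(1) by (intro height_parent) auto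
      moreover have "h v < h w" unfolding that(4) using that(2) by (intro height_parent) auto
      ultimately show False by simp
    qed
    show ?thesis
    proof (rule equals0I)
      fix e assume "e \<in> (\<lambda>v. (v, p v)) ` ?E \<inter> (\<lambda>v. (p v, v)) ` ?E"
      then obtain v w where "v \<in> ?E" "w \<in> ?E" "e = (v, p v)" "e = (p w, w)"
        by (elim IntE imageE) (rule that)
      then show False using no_2_cycle[of v w] by (metis prod.inject)
    qed
  qed
  moreover have "(\<Sum>(u, w)\<in>(\<lambda>v. (v, p v)) ` ?E. f u w) = (\<Sum>v\<in>?E. f v (p v))"
    using sum.reindex[of "\<lambda>v. (v, p v)" ?E "\<lambda>(u, w). f u w"] by (simp add: inj_on_def o_def)
  moreover have "(\<Sum>(u, w)\<in>(\<lambda>v. (p v, v)) ` ?E. f u w) = (\<Sum>v\<in>?E. f (p v) v)"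
    using sum.reindex[of "\<lambda>v. (p v, v)" ?E "\<lambda>(u, w). f u w"] by (simp add: inj_on_def o_def)
  moreover have "finite ?E" by simp
  ultimately show ?thesis by (simp only: sum.union_disjoint finite_imageI sum.distrib)
qed

lemma out_degree_eq: "out_degree G u = card {w \<in> verts G. u \<rightarrow>\<^bsub>G\<^esub> w}"
proof -
  have "{w \<in> verts G. u \<rightarrow>\<^bsub>G\<^esub> w} = head G ` out_arcs G u"
    by (auto simp: out_arcs_def arcs_ends_conv image_iff)
  moreover have "inj_on (head G) (out_arcs G u)"
    using no_multi_arcs by (auto simp: inj_on_def out_arcs_def arc_to_ends_def)
  ultimately show ?thesis by (simp add: out_degree_def card_image)
qed

text \<open>
  The Laplacian indexed by vertices, which separates its algebra from the enumeration that numbers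
  the rows of \<open>laplacian_mat\<close>.
\<close>

definition laplacian :: "'a \<Rightarrow> 'a \<Rightarrow> real" where
  "laplacian u w = (if u = w then real (out_degree G u) else 0) - of_bool (u \<rightarrow>\<^bsub>G\<^esub> w)"

text \<open>
  An edge contributes to two diagonal and two off-diagonal entries of the Laplacian, and the four
  terms combine to a product of differences.  The coefficients are arbitrary, because the form is
  needed both over the reals and for complex eigenvectors.
\<close>

lemma laplacian_form:
  fixes x y :: "'a \<Rightarrow> 'c::{real_algebra_1, comm_ring_1}"
  shows "(\<Sum>u\<in>verts G. \<Sum>w\<in>verts G. x u * of_real (laplacian u w) * y w)
    = (\<Sum>v\<in>verts G - {r}. (x v - x (p v)) * (y v - y (p v)))"
proof -
  let ?V = "verts G"
  have "(\<Sum>w\<in>?V. x u * of_real (laplacian u w) * y w)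
      = (\<Sum>w\<in>?V. of_bool (u \<rightarrow>\<^bsub>G\<^esub> w) * (x u * (y u - y w)))" if u: "u \<in> ?V" for u
  proof -
    have "(\<Sum>w\<in>?V. x u * of_real (laplacian u w) * y w)
        = (\<Sum>w\<in>?V. (if u = w then of_nat (out_degree G u) * x u * y w else 0)
            - of_bool (u \<rightarrow>\<^bsub>G\<^esub> w) * x u * y w)"
      by (intro sum.cong) (auto simp: laplacian_def algebra_simps)
    also have "\<dots> = of_nat (out_degree G u) * x u * y u - (\<Sum>w\<in>?V. of_bool (u \<rightarrow>\<^bsub>G\<^esub> w) * x u * y w)"
      using u by (simp add: sum_subtractf)
    also have "of_nat (out_degree G u) = (\<Sum>w\<in>?V. of_bool (u \<rightarrow>\<^bsub>G\<^esub> w) :: 'c)"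
      by (simp add: out_degree_eq Int_def)
    finally show ?thesis
      unfolding sum_distrib_right sum_subtractf[symmetric]
      by (simp only: right_diff_distrib mult.assoc)
  qed
  then have "(\<Sum>u\<in>?V. \<Sum>w\<in>?V. x u * of_real (laplacian u w) * y w)
      = (\<Sum>u\<in>?V. \<Sum>w\<in>?V. of_bool (u \<rightarrow>\<^bsub>G\<^esub> w) * (x u * (y u - y w)))"
    by (rule sum.cong[OF refl])
  also have "\<dots> = (\<Sum>(u, w)\<in>?V \<times> ?V. of_bool (u \<rightarrow>\<^bsub>G\<^esub> w) * (x u * (y u - y w)))"
    by (rule sum.cartesian_product)
  also have "\<dots> = (\<Sum>(u, w)\<in>arcs_ends G. x u * (y u - y w))"
    by (rule sum.mono_neutral_cong_right) (auto dest: adj_in_verts)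
  also have "\<dots> = (\<Sum>v\<in>?V - {r}. (x v - x (p v)) * (y v - y (p v)))"
    unfolding sum_arcs_ends by (intro sum.cong) (auto simp: algebra_simps)
  finally show ?thesis .
qed

abbreviation "N \<equiv> card (verts G)"
abbreviation "vs \<equiv> vertex_enum G"

lemma vertex_enum: "distinct vs" "set vs = verts G"
proof -
  have "\<exists>xs. distinct xs \<and> set xs = verts G" using finite_distinct_list[of "verts G"] by auto
  then have "distinct vs \<and> set vs = verts G" unfolding vertex_enum_def by (rule someI_ex)
  then show "distinct vs" "set vs = verts G" by auto
qed

lemma length_vertex_enum: "length vs = N"
  using vertex_enum distinct_card by metis

lemma bij_vertex_enum: "bij_betw ((!) vs) {..<N} (verts G)"
  using bij_betw_nth vertex_enum length_vertex_enum by metis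

lemma sum_vertex_enum: "(\<Sum>i<N. f (vs ! i)) = sum f (verts G)"
  by (rule sum.reindex_bij_betw[OF bij_vertex_enum])

lemma laplacian_mat_closed: "laplacian_mat G \<in> carrier_mat N N"
  unfolding laplacian_mat_def adjacency_mat_def by (intro minus_carrier_mat) simp

lemma laplacian_mat_index: "i < N \<Longrightarrow> j < N \<Longrightarrow> laplacian_mat G $$ (i, j) = laplacian (vs ! i) (vs ! j)"
  using nth_eq_iff_index_eq[OF vertex_enum(1)] length_vertex_enum
  by (auto simp: laplacian_mat_def degree_mat_def adjacency_mat_def laplacian_def)

lemma laplacian_mat_form:
  fixes x y :: "'a \<Rightarrow> 'c::{real_algebra_1, comm_ring_1}"
  shows "(\<Sum>i<N. \<Sum>j<N. x (vs ! i) * of_real (laplacian_mat G $$ (i, j)) * y (vs ! j))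
    = (\<Sum>v\<in>verts G - {r}. (x v - x (p v)) * (y v - y (p v)))"
proof -
  have "(\<Sum>i<N. \<Sum>j<N. x (vs ! i) * of_real (laplacian_mat G $$ (i, j)) * y (vs ! j))
      = (\<Sum>i<N. \<Sum>j<N. x (vs ! i) * of_real (laplacian (vs ! i) (vs ! j)) * y (vs ! j))"
    by (simp add: laplacian_mat_index)
  also have "\<dots> = (\<Sum>i<N. \<Sum>w\<in>verts G. x (vs ! i) * of_real (laplacian (vs ! i) w) * y w)"
    by (intro sum.cong refl sum_vertex_enum)
  also have "\<dots> = (\<Sum>u\<in>verts G. \<Sum>w\<in>verts G. x u * of_real (laplacian u w) * y w)"
    by (rule sum_vertex_enum)
  finally show ?thesis by (simp only: laplacian_form)
qed

text \<open>
  At a complex vector the form is the sum of the squared moduli of its differences along the edges.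
\<close>

lemma laplacian_roots:
  "\<exists>bs. char_poly (laplacian_mat G) = (\<Prod>b\<leftarrow>bs. [:- b, 1:]) \<and> length bs = N \<and> (\<forall>b\<in>set bs. b \<ge> 0)"
proof (rule real_roots_nonneg_if_form_nonneg[OF laplacian_mat_closed])
  fix x :: "nat \<Rightarrow> complex"
  define z where "z v = x (inv_into {..<N} ((!) vs) v)" for v
  have z: "z (vs ! i) = x i" if "i < N" for i
    using that bij_vertex_enum by (simp add: z_def bij_betw_def)
  define S where "S = (\<Sum>v\<in>verts G - {r}. (cmod (z v - z (p v)))\<^sup>2)"
  have "(\<Sum>i<N. \<Sum>j<N. cnj (x i) * of_real (laplacian_mat G $$ (i, j)) * x j)
      = (\<Sum>v\<in>verts G - {r}. (cnj (z v) - cnj (z (p v))) * (z v - z (p v)))"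
    by (subst laplacian_mat_form[symmetric]) (auto intro!: sum.cong simp: z)
  also have "\<dots> = of_real S"
    unfolding S_def of_real_sum complex_norm_square by (simp add: mult.commute)
  finally have "(\<Sum>i<N. \<Sum>j<N. cnj (x i) * of_real (laplacian_mat G $$ (i, j)) * x j) = of_real S" .
  moreover have "S \<ge> 0" by (simp add: S_def sum_nonneg)
  ultimately show "\<exists>c\<ge>0. (\<Sum>i<N. \<Sum>j<N. cnj (x i) * of_real (laplacian_mat G $$ (i, j)) * x j) = of_real c"
    by blast
qed

text \<open>
  The indicator of the subtree below \<open>e\<close>, that is, of one side of the cut made by removing the edge
  above \<open>e\<close>, shifted to have sum zero.  The root, which has no such edge, stands for the constant
  vector, the kernel of the Laplacian.
\<close>

definition cut_vector :: "'a \<Rightarrow> 'a \<Rightarrow> real" where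
  "cut_vector e v = (if e = r then 1 else descendant p e v - subtree_size e / N)"

lemma card_verts_pos: "N > 0"
  using root_in finite_V card_gt_0_iff by blast

text \<open>
  Shifting by a constant does not change differences along edges, so the cut vectors are
  orthonormal for the Laplacian form except that the constant one is isotropic.
\<close>

lemma cut_vector_form:
  assumes "e \<in> verts G" "f \<in> verts G"
  shows "(\<Sum>v\<in>verts G - {r}. (cut_vector e v - cut_vector e (p v)) * (cut_vector f v - cut_vector f (p v)))
    = of_bool (e = f \<and> e \<noteq> r)"
proof -
  have "cut_vector e v - cut_vector e (p v) = of_bool (e = v)" if "v \<in> verts G - {r}" for e v
    using that descendant_diff[of v e] by (auto simp: cut_vector_def)
  then have "(\<Sum>v\<in>verts G - {r}. (cut_vector e v - cut_vector e (p v)) * (cut_vector f v - cut_vector f (p v)))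
      = (\<Sum>v\<in>verts G - {r}. of_bool (e = v) * of_bool (f = v))"
    by simp
  also have "\<dots> = (\<Sum>v\<in>verts G - {r}. if v = e then of_bool (f = e) else 0)"
    by (intro sum.cong) auto
  also have "\<dots> = of_bool (e = f \<and> e \<noteq> r)"
    using assms finite_V by (auto simp: sum.delta)
  finally show ?thesis .
qed

text \<open>
  Centring makes the cut vectors orthogonal to the constant one, which isolates the row of the root
  in their Gram matrix.
\<close>

lemma cut_vector_gram:
  "(\<Sum>v\<in>verts G. cut_vector r v * cut_vector r v) = N"
  "e \<noteq> r \<Longrightarrow> (\<Sum>v\<in>verts G. cut_vector r v * cut_vector e v) = 0"
  "e \<noteq> r \<Longrightarrow> (\<Sum>v\<in>verts G. cut_vector e v * cut_vector e v) = subtree_size e * (N - subtree_size e) / N"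
proof -
  show "(\<Sum>v\<in>verts G. cut_vector r v * cut_vector r v) = N" by (simp add: cut_vector_def)
  show "(\<Sum>v\<in>verts G. cut_vector r v * cut_vector e v) = 0" if "e \<noteq> r"
    using that card_verts_pos by (simp add: cut_vector_def sum_subtractf)
  show "(\<Sum>v\<in>verts G. cut_vector e v * cut_vector e v) = subtree_size e * (N - subtree_size e) / N" if "e \<noteq> r"
  proof -
    define s where "s = subtree_size e"
    have cut: "cut_vector e v = descendant p e v - s / N" for v
      unfolding cut_vector_def s_def using that by (simp only: if_False)
    have idem: "descendant p e v * descendant p e v = descendant p e v" for v
      by (simp add: descendant_def)
    have "(\<Sum>v\<in>verts G. cut_vector e v * cut_vector e v)
        = (\<Sum>v\<in>verts G. descendant p e v - 2 * (s / N) * descendant p e v + (s / N)\<^sup>2)"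
    proof (intro sum.cong refl)
      fix v
      have "(d - t) * (d - t) = d * d - 2 * t * d + t\<^sup>2" for d t :: real
        by (simp add: algebra_simps power2_eq_square)
      then show "cut_vector e v * cut_vector e v
          = descendant p e v - 2 * (s / N) * descendant p e v + (s / N)\<^sup>2"
        unfolding cut by (simp only: idem)
    qed
    also have "\<dots> = s - 2 * (s / N) * s + N * (s / N)\<^sup>2"
      unfolding s_def by (simp only: sum.distrib sum_subtractf sum_distrib_left[symmetric] sum_constant)
    also have "\<dots> = s * (N - s) / N"
    proof -
      have "real N \<noteq> 0" using card_verts_pos by (metis of_nat_0_eq_iff less_irrefl)
      then show ?thesis by (simp add: field_simps power2_eq_square del: of_nat_eq_0_iff card_eq_0_iff)
    qed
    finally show ?thesis by (simp add: s_def)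
  qed
qed

text \<open>
  In the family of cut vectors the pencil of the Laplacian and the identity becomes \<open>x G - D\<close> with
  \<open>G\<close> the Gram matrix, so the sum of the reciprocals of the nonzero eigenvalues is the sum of the
  diagonal entries \<open>s * (N - s) / N\<close> of \<open>G\<close> over all subtree sizes \<open>s\<close>.  By the double count of
  distances this is \<open>wiener_sum / (2 * N)\<close>, and the norm carries a further factor \<open>1 / 2\<close>.
\<close>

lemma H2_norm_eq_wiener: "H2_norm G = sqrt (real (wiener_sum p (verts G)) / (4 * N))"
proof -
  let ?L = "laplacian_mat G"
  define F where "F = mat N N (\<lambda>(i, j). cut_vector (vs ! i) (vs ! j))"
  define g where "g i j = (\<Sum>v\<in>verts G. cut_vector (vs ! i) v * cut_vector (vs ! j) v)" for i j
  obtain k where k: "k < N" "vs ! k = r"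
    using root_in bij_vertex_enum by (metis bij_betw_imp_surj_on imageE lessThan_iff)
  have vs_eq: "vs ! i = vs ! j \<longleftrightarrow> i = j" if "i < N" "j < N" for i j
    using that vertex_enum(1) length_vertex_enum by (simp add: nth_eq_iff_index_eq)
  have vs_in: "vs ! i \<in> verts G" if "i < N" for i
    using that vertex_enum length_vertex_enum by (metis nth_mem)
  have F: "F \<in> carrier_mat N N" by (simp add: F_def)
  have L: "?L \<in> carrier_mat N N" by (rule laplacian_mat_closed)
  have D: "F * ?L * transpose_mat F = mat N N (\<lambda>(i, j). of_bool (i = j \<and> i \<noteq> k))"
  proof (rule eq_matI)
    fix i j assume "i < dim_row (mat N N (\<lambda>(i, j). of_bool (i = j \<and> i \<noteq> k)) :: real mat)"
      "j < dim_col (mat N N (\<lambda>(i, j). of_bool (i = j \<and> i \<noteq> k)) :: real mat)"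
    then have ij: "i < N" "j < N" by auto
    have "(F * ?L * transpose_mat F) $$ (i, j)
        = (\<Sum>b<N. \<Sum>a<N. cut_vector (vs ! i) (vs ! a) * ?L $$ (a, b) * cut_vector (vs ! j) (vs ! b))"
      using ij F L by (simp add: scalar_prod_def F_def sum_distrib_right atLeast0LessThan)
    also have "\<dots> = (\<Sum>a<N. \<Sum>b<N. cut_vector (vs ! i) (vs ! a) * of_real (?L $$ (a, b)) * cut_vector (vs ! j) (vs ! b))"
      by (subst sum.swap) simp
    also have "\<dots> = of_bool (i = j \<and> i \<noteq> k)"
      unfolding laplacian_mat_form using cut_vector_form[of "vs ! i" "vs ! j"] ij k vs_eq vs_in by auto
    finally show "(F * ?L * transpose_mat F) $$ (i, j) = mat N N (\<lambda>(i, j). of_bool (i = j \<and> i \<noteq> k)) $$ (i, j)"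
      using ij by simp
  qed (use F L in auto)
  have G: "F * transpose_mat F = mat N N (\<lambda>(i, j). g i j)"
  proof (rule eq_matI)
    fix i j assume "i < dim_row (mat N N (\<lambda>(i, j). g i j))" "j < dim_col (mat N N (\<lambda>(i, j). g i j))"
    then have ij: "i < N" "j < N" by auto
    then have "(F * transpose_mat F) $$ (i, j)
        = (\<Sum>a<N. cut_vector (vs ! i) (vs ! a) * cut_vector (vs ! j) (vs ! a))"
      by (simp add: F_def scalar_prod_def atLeast0LessThan)
    also have "\<dots> = g i j"
      unfolding g_def by (rule sum_vertex_enum[of "\<lambda>v. cut_vector (vs ! i) v * cut_vector (vs ! j) v"])
    finally show "(F * transpose_mat F) $$ (i, j) = mat N N (\<lambda>(i, j). g i j) $$ (i, j)"
      using ij by simp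
  qed (use F in auto)
  have row: "\<forall>j<N. j \<noteq> k \<longrightarrow> g k j = 0"
    using k vs_eq[of _ k] cut_vector_gram(2) by (auto simp: g_def)
  have "g k k = N" unfolding g_def k(2) by (rule cut_vector_gram(1))
  then have gkk: "g k k \<noteq> 0" using card_verts_pos by (metis of_nat_0_eq_iff less_irrefl)
  note coeffs = char_poly_low_coeffs[OF L F k(1) D G row gkk]
  let ?f = "\<lambda>e. subtree_size e * (N - subtree_size e) / N"
  have "(\<Sum>i\<in>{0..<N} - {k}. g i i) = (\<Sum>i\<in>{0..<N} - {k}. ?f (vs ! i))"
  proof (intro sum.cong refl)
    fix i assume "i \<in> {0..<N} - {k}"
    then show "g i i = ?f (vs ! i)"
      using k vs_eq[of i k] cut_vector_gram(3) by (auto simp: g_def)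
  qed
  also have "\<dots> = sum ?f (verts G - {r})"
  proof (rule sum.reindex_bij_betw)
    show "bij_betw ((!) vs) ({0..<N} - {k}) (verts G - {r})"
      using bij_betw_DiffI[OF bij_vertex_enum, of "{k}" "{r}"] k root_in by (auto simp: atLeast0LessThan)
  qed
  also have "\<dots> = (\<Sum>e\<in>verts G. subtree_size e * (N - subtree_size e)) / N"
  proof -
    have "?f r = 0" unfolding subtree_size_root by simp
    then have "sum ?f (verts G - {r}) = sum ?f (verts G)"
      using sum.remove[OF finite_V root_in, of ?f] by (simp only: add_0)
    then show ?thesis by (simp only: sum_divide_distrib)
  qed
  also have "\<dots> = wiener_sum p (verts G) / (2 * N)"
    unfolding wiener_sum_subtree_sizes by simp
  finally have tr: "(\<Sum>i\<in>{0..<N} - {k}. g i i) = wiener_sum p (verts G) / (2 * N)" .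
  obtain bs where bs: "char_poly ?L = (\<Prod>b\<leftarrow>bs. [:- b, 1:])" "length bs = N" "\<forall>b\<in>set bs. b \<ge> 0"
    using laplacian_roots by auto
  have "(\<Sum>i = 2..N. 1 / (2 * laplacian_eigenvalue G i)) = - coeff (char_poly ?L) 2 / (2 * coeff (char_poly ?L) 1)"
    unfolding laplacian_eigenvalue_def using sum_inverse_roots[OF bs(1,3) coeffs(1,2)] bs(2) by simp
  also have "\<dots> = real (wiener_sum p (verts G)) / (4 * N)"
    unfolding coeffs(3) tr using coeffs(2) by simp
  finally show ?thesis by (simp add: H2_norm_def)
qed

end

section \<open>Undirected trees as rooted trees\<close>

text \<open>
  Truncated subtraction makes \<open>0\<close> its own parent, as required of the root.
\<close>

lemma parent_tree_graph_path:
  assumes "N > 0"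
  shows "parent_tree_graph (path_graph N) 0 (\<lambda>v. v - 1) (\<lambda>v. v)"
proof -
  interpret graph "path_graph N" by (rule graph_path_graph)
  show ?thesis
  proof
    show "u \<rightarrow>\<^bsub>path_graph N\<^esub> w \<longleftrightarrow> (u \<in> verts (path_graph N) - {0} \<and> w = u - 1)
        \<or> (w \<in> verts (path_graph N) - {0} \<and> u = w - 1)" for u w
      by (auto simp: arcs_ends_conv path_graph_def image_iff)
  qed (use assms in \<open>auto simp: path_graph_def\<close>)
qed

text \<open>
  The parent edges alone connect any two vertices.  If an edge from \<open>u\<close> to \<open>w\<close> is not among them, a
  simple path of parent edges from \<open>w\<close> back to \<open>u\<close> closes it to a cycle.  The path has at least two
  edges, because a single one would be the given edge reversed, which is not a parent edge either.
\<close>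

lemma (in graph) edge_is_parent_edge:
  assumes acyclic: "\<not> (\<exists>c. cycle c \<and> 3 \<le> length c)"
    and tree: "rooted_tree (verts G) r p h"
    and parent_adj: "\<And>v. v \<in> verts G \<Longrightarrow> v \<noteq> r \<Longrightarrow> v \<rightarrow>\<^bsub>G\<^esub> p v"
    and uw: "u \<rightarrow>\<^bsub>G\<^esub> w"
  shows "(u \<in> verts G - {r} \<and> w = p u) \<or> (w \<in> verts G - {r} \<and> u = p w)"
proof (rule ccontr)
  assume no: "\<not> ?thesis"
  interpret rooted_tree "verts G" r p h by (rule tree)
  define R where "R = {(v, p v) |v. v \<in> verts G - {r}} \<union> {(p v, v) |v. v \<in> verts G - {r}}"
  have not_R: "(u, w) \<notin> R" "(w, u) \<notin> R" using no by (auto simp: R_def)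
  define H where "H = G\<lparr>arcs := {a \<in> arcs G. (tail G a, head G a) \<in> R}\<rparr>"
  interpret H: wf_digraph H by unfold_locales (auto simp: H_def)
  have sub: "subgraph H G"
    by (auto simp: subgraph_def compatible_def H.wf_digraph wf_digraph) (auto simp: H_def)
  have H_adj: "v \<rightarrow>\<^bsub>H\<^esub> x \<longleftrightarrow> v \<rightarrow>\<^bsub>G\<^esub> x \<and> (v, x) \<in> R" for v x
    by (auto simp: H_def arcs_ends_conv)
  have sym: "v \<rightarrow>\<^bsub>G\<^esub> x \<Longrightarrow> x \<rightarrow>\<^bsub>G\<^esub> v" for v x using sym_arcs by (rule arcs_ends_symmetric)
  have up: "v \<rightarrow>\<^sup>*\<^bsub>H\<^esub> r \<and> r \<rightarrow>\<^sup>*\<^bsub>H\<^esub> v" if "v \<in> verts G" for v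
    using that
  proof (induction "h v" arbitrary: v rule: less_induct)
    case less
    show ?case
    proof (cases "v = r")
      case True
      have "r \<in> verts H" using root_in by (simp add: H_def)
      then show ?thesis using True by auto
    next
      case False
      have "v \<rightarrow>\<^bsub>H\<^esub> p v" "p v \<rightarrow>\<^bsub>H\<^esub> v"
        using parent_adj[OF less.prems False] sym less.prems False by (auto simp: H_adj R_def)
      moreover have "p v \<rightarrow>\<^sup>*\<^bsub>H\<^esub> r \<and> r \<rightarrow>\<^sup>*\<^bsub>H\<^esub> p v"
        using less.hyps[of "p v"] height_parent[OF less.prems False] parent_in[OF less.prems] by blast
      ultimately show ?thesis
        using H.adj_reachable_trans H.reachable_adj_trans by blast
    qed
  qed
  have "w \<rightarrow>\<^sup>*\<^bsub>H\<^esub> u" using up adj_in_verts[OF uw] H.reachable_trans by blast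
  then obtain q where q: "H.apath w q u" using H.reachable_apath by blast
  then have Gq: "apath w q u" using sub by (rule subgraph_apath_imp_apath)
  obtain a where a: "a \<in> arcs G" "tail G a = u" "head G a = w" using uw by (rule reachableE)
  have "cycle (a # q)"
    unfolding cycle_def using a Gq by (auto simp: apath_def awalk_Cons_iff intro!: exI[of _ u])
  moreover have "3 \<le> length (a # q)"
  proof -
    have "q \<noteq> []" using Gq a no_loops[OF a(1)] by (auto simp: apath_def awalk_Nil_iff)
    moreover have "q \<noteq> [b]" for b
    proof
      assume "q = [b]"
      then have "w \<rightarrow>\<^bsub>H\<^esub> u" using q
        by (auto simp: H.apath_def H.awalk_Cons_iff H.awalk_Nil_iff arcs_ends_conv)
      then show False using not_R H_adj by simp
    qed
    ultimately show ?thesis by (cases q; cases "tl q") auto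
  qed
  ultimately show False using acyclic by blast
qed

text \<open>
  Any vertex \<open>r\<close> can serve as root: the height of a vertex is its distance from \<open>r\<close>, and its parent is
  a neighbour nearer to \<open>r\<close>.
\<close>

lemma undirected_tree_parent:
  assumes T: "undirected_tree T" and r: "r \<in> verts T"
  shows "\<exists>p h. parent_tree_graph T r p h"
proof -
  interpret graph T using T by (simp add: undirected_tree_def)
  let ?E = "arcs_ends T"
  have reach: "\<exists>n. (r, v) \<in> ?E ^^ n" if "v \<in> verts T" for v
  proof -
    have "r \<rightarrow>\<^sup>*\<^bsub>T\<^esub> v"
      using T r that unfolding undirected_tree_def Digraph_Component.connected_def strongly_connected_def
      by (simp add: reachable_mk_symmetric_eq[OF sym_arcs])
    then show ?thesis by (metis reachable_rtranclI rtrancl_power)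
  qed
  define h where "h v = (LEAST n. (r, v) \<in> ?E ^^ n)" for v
  have closer: "\<exists>w. v \<rightarrow>\<^bsub>T\<^esub> w \<and> h w < h v" if v: "v \<in> verts T" "v \<noteq> r" for v
  proof -
    have hv: "(r, v) \<in> ?E ^^ h v" unfolding h_def using reach[OF v(1)] by (rule LeastI_ex)
    then obtain m where m: "h v = Suc m" using v(2) by (cases "h v") auto
    then obtain w where w: "(r, w) \<in> ?E ^^ m" "(w, v) \<in> ?E" using hv by auto
    have "h w \<le> m" unfolding h_def using w(1) by (rule Least_le)
    then show ?thesis using m w(2) arcs_ends_symmetric[OF sym_arcs] by (auto simp: less_Suc_eq_le)
  qed
  define p where "p v = (if v = r then r else SOME w. v \<rightarrow>\<^bsub>T\<^esub> w \<and> h w < h v)" for v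
  have p: "v \<rightarrow>\<^bsub>T\<^esub> p v \<and> h (p v) < h v" if "v \<in> verts T" "v \<noteq> r" for v
    using someI_ex[OF closer[OF that]] that by (simp add: p_def)
  have tree: "rooted_tree (verts T) r p h"
  proof
    show "p v \<in> verts T" if "v \<in> verts T" for v
      using that p[of v] adj_in_verts(2) r by (cases "v = r") (auto simp: p_def)
  qed (use r p in \<open>auto simp: p_def\<close>)
  interpret rooted_tree "verts T" r p h by (rule tree)
  have "parent_tree_graph T r p h"
  proof
    fix u w
    show "u \<rightarrow>\<^bsub>T\<^esub> w \<longleftrightarrow> (u \<in> verts T - {r} \<and> w = p u) \<or> (w \<in> verts T - {r} \<and> u = p w)"
      using edge_is_parent_edge[OF _ tree] T p arcs_ends_symmetric[OF sym_arcs]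
      unfolding undirected_tree_def by blast
  qed
  then show ?thesis by blast
qed

section \<open>Extremality of the path\<close>

theorem theorem2:
  fixes N :: nat and T :: "('a, 'b) pre_digraph"
  assumes "N > 0"
    and "undirected_tree T"
    and "card (verts T) = N"
  shows "H2_norm T \<le> H2_norm (path_graph N)"
proof -
  obtain r where "r \<in> verts T" using assms(1,3) by (metis card.empty ex_in_conv less_irrefl)
  then obtain p h where "parent_tree_graph T r p h" using undirected_tree_parent[OF assms(2)] by blast
  then interpret T: parent_tree_graph T r p h .
  interpret P: parent_tree_graph "path_graph N" 0 "\<lambda>v. v - 1" "\<lambda>v. v"
    using assms(1) by (rule parent_tree_graph_path)
  have "wiener_sum p (verts T) \<le> wiener_sum (\<lambda>v. v - 1) (verts (path_graph N))"
    using wiener_sum_le[OF T.rooted_tree_axioms] wiener_sum_path[of N] assms(3)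
    by (simp add: path_graph_def atLeast0LessThan)
  then show ?thesis
    unfolding T.H2_norm_eq_wiener P.H2_norm_eq_wiener card_verts_path_graph assms(3)
    by (intro real_sqrt_le_mono divide_right_mono) auto
qed

end
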